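(* Let $(X,f)$ be a topological dynamical system. If $(X,f)$ has a semi-horseshoe, then $(X,f)$ is Bohr chaotic.
   Context: A topological dynamical system $(X,f)$ consists of a compact metric space $X$ and a continuous map $f:X\to X$. For $N\ge 1$, a subsystem $(\Lambda,f^N)$ of $(X,f^N)$ is a nonempty compact set $\Lambda\subset X$ with $f^N(\Lambda)\subset\Lambda$. Let $\sigma$ denote the left shift $\sigma(x)_i=x_{i+1}$ on $\{0,1\}^{\mathbb N}$ ($\mathbb N=\{0,1,2,\dots\}$) or on $\{0,1\}^{\mathbb Z}$, with the product topology. For an integer $N\geq 1$, a subsystem $(\Lambda,f^N)$ of $(X,f^N)$ is a one-sided (resp. two-sided) $N$-order semi-horseshoe of $(X,f)$ if there is a continuous surjection $\pi:\Lambda\to\{0,1\}^{\mathbb N}$ (resp. $\{0,1\}^{\mathbb Z}$) with $\pi\circ f^N=\sigma\circ\pi$. $(X,f)$ has a semi-horseshoe if it has a one-sided or a two-sided $N$-order semi-horseshoe for some $N\ge 1$. A bounded real sequence $\vartheta=(\vartheta_n)_{n\ge 0}\in\ell^\infty(\mathbb N)$ is a non-trivial weight if $\limsup_{N\to\infty}\frac1N\sum_{n=0}^{N-1}|\vartheta_n|>0$. $(X,f)$ is Bohr chaotic if for every non-trivial weight $\vartheta$ there exist a continuous function $\varphi:X\to\mathbb R$ and $x\in X$ such that $\limsup_{N\to\infty}\frac1N\left|\sum_{n=0}^{N-1}\vartheta_n\varphi(f^nx)\right|>0$. *)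

theory Defs
  imports "HOL-Analysis.Analysis"
begin

definition top_dyn_system :: "'a::metric_space set \<Rightarrow> ('a \<Rightarrow> 'a) \<Rightarrow> bool" where
  "top_dyn_system X f \<longleftrightarrow> compact X \<and> continuous_on X f \<and> f ` X \<subseteq> X"

definition subsystem_of_iterate ::
    "'a::metric_space set \<Rightarrow> ('a \<Rightarrow> 'a) \<Rightarrow> nat \<Rightarrow> 'a set \<Rightarrow> bool" where
  "subsystem_of_iterate X f N \<Lambda> \<longleftrightarrow>
     \<Lambda> \<noteq> {} \<and> compact \<Lambda> \<and> \<Lambda> \<subseteq> X \<and> (f ^^ N) ` \<Lambda> \<subseteq> \<Lambda>"

text \<open>
  The alphabet \<open>{0, 1}\<close> is represented by the type \<^typ>\<open>bool\<close>, whose topology is discrete.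
  The types \<^typ>\<open>nat \<Rightarrow> bool\<close> and \<^typ>\<open>int \<Rightarrow> bool\<close> carry the product topology, so they are
  the one-sided and the two-sided full shift on two symbols.
\<close>

definition left_shift :: "('i::semiring_1 \<Rightarrow> bool) \<Rightarrow> 'i \<Rightarrow> bool" where
  "left_shift x = (\<lambda>i. x (i + 1))"

definition one_sided_semi_horseshoe ::
    "'a::metric_space set \<Rightarrow> ('a \<Rightarrow> 'a) \<Rightarrow> nat \<Rightarrow> 'a set \<Rightarrow> bool" where
  "one_sided_semi_horseshoe X f N \<Lambda> \<longleftrightarrow>
     N \<ge> 1 \<and> subsystem_of_iterate X f N \<Lambda> \<and>
     (\<exists>\<pi> :: 'a \<Rightarrow> nat \<Rightarrow> bool. continuous_on \<Lambda> \<pi> \<and> \<pi> ` \<Lambda> = UNIV \<and>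
        (\<forall>x\<in>\<Lambda>. \<pi> ((f ^^ N) x) = left_shift (\<pi> x)))"

definition two_sided_semi_horseshoe ::
    "'a::metric_space set \<Rightarrow> ('a \<Rightarrow> 'a) \<Rightarrow> nat \<Rightarrow> 'a set \<Rightarrow> bool" where
  "two_sided_semi_horseshoe X f N \<Lambda> \<longleftrightarrow>
     N \<ge> 1 \<and> subsystem_of_iterate X f N \<Lambda> \<and>
     (\<exists>\<pi> :: 'a \<Rightarrow> int \<Rightarrow> bool. continuous_on \<Lambda> \<pi> \<and> \<pi> ` \<Lambda> = UNIV \<and>
        (\<forall>x\<in>\<Lambda>. \<pi> ((f ^^ N) x) = left_shift (\<pi> x)))"

definition has_semi_horseshoe :: "'a::metric_space set \<Rightarrow> ('a \<Rightarrow> 'a) \<Rightarrow> bool" where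
  "has_semi_horseshoe X f \<longleftrightarrow>
     (\<exists>N \<Lambda>. one_sided_semi_horseshoe X f N \<Lambda> \<or> two_sided_semi_horseshoe X f N \<Lambda>)"

text \<open>
  The limits superior below are taken in \<^typ>\<open>ereal\<close>, since \<^const>\<open>limsup\<close> needs a complete
  lattice; the sequences involved are bounded, so this is the real limit superior.
\<close>

definition nontrivial_weight :: "(nat \<Rightarrow> real) \<Rightarrow> bool" where
  "nontrivial_weight \<theta> \<longleftrightarrow> bounded (range \<theta>) \<and>
     limsup (\<lambda>N. ereal (1 / real N * (\<Sum>n<N. \<bar>\<theta> n\<bar>))) > 0"

definition Bohr_chaotic :: "'a::metric_space set \<Rightarrow> ('a \<Rightarrow> 'a) \<Rightarrow> bool" where
  "Bohr_chaotic X f \<longleftrightarrow>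
     (\<forall>\<theta>. nontrivial_weight \<theta> \<longrightarrow>
        (\<exists>\<phi> :: 'a \<Rightarrow> real. \<exists>x\<in>X. continuous_on X \<phi> \<and>
           limsup (\<lambda>N. ereal (1 / real N * \<bar>\<Sum>n<N. \<theta> n * \<phi> ((f ^^ n) x)\<bar>)) > 0))"

end

theory Submission
  imports Defs
begin

text \<open>
  Along a residue class modulo a period \<open>R\<close> the weight is still nontrivial, and a point coded by the
  signs of the weight on this class correlates with it there. The other iterates \<open>f\<^sup>tx\<close>, \<open>R\<close> not
  dividing \<open>t\<close>, may cancel this correlation unless the test function vanishes at them. So the
  point is to find an extension \<open>M\<close> of the full shift by some iterate \<open>f\<^sup>T\<close> and a word \<open>w\<close> such that
  points of \<open>M\<close> whose code begins with \<open>w\<close> are in none of the images \<open>f\<^sup>t(M)\<close>, \<open>0 < t < T\<close>. A test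
  function that reads the symbol following the word \<open>w\<close> then does the job.
\<close>

subsection \<open>Limits superior of averages along residue classes\<close>

lemma frequently_less_if_less_limsup:
  fixes u :: "nat \<Rightarrow> real"
  assumes "limsup (\<lambda>n. ereal (u n)) > 0"
  obtains e where "e > 0" "\<exists>\<^sub>F n in sequentially. u n > e"
proof -
  obtain e where e: "0 < ereal e" "ereal e < limsup (\<lambda>n. ereal (u n))"
    using ereal_dense2[OF assms] by auto
  have "\<exists>\<^sub>F n in sequentially. u n > e"
  proof (rule ccontr)
    assume "\<not> ?thesis"
    then have "\<forall>\<^sub>F n in sequentially. ereal (u n) \<le> ereal e"
      by (simp add: not_frequently not_less)
    then have "limsup (\<lambda>n. ereal (u n)) \<le> ereal e"
      by (rule Limsup_bounded)
    with e show False by simp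
  qed
  with e that show thesis by simp
qed

lemma less_limsup_if_frequently_less:
  fixes u :: "nat \<Rightarrow> real"
  assumes "e > 0" "\<exists>\<^sub>F n in sequentially. u n > e"
  shows "limsup (\<lambda>n. ereal (u n)) > 0"
proof (rule ccontr)
  assume "\<not> ?thesis"
  then have "limsup (\<lambda>n. ereal (u n)) < ereal e"
    using assms(1) by (simp add: not_less order_le_less_trans)
  then have "\<forall>\<^sub>F n in sequentially. ereal (u n) < ereal e"
    by (rule Limsup_lessD)
  then have "\<forall>\<^sub>F n in sequentially. \<not> u n > e"
    by (rule eventually_mono) simp
  with assms(2) show False by (simp add: frequently_def)
qed

text \<open>The average is the sum of its \<open>R\<close> residue parts, so whenever it exceeds
  \<open>e\<close>, some part exceeds \<open>e / R\<close>. The residue may depend on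
  \<open>t\<close>, but one of the finitely many residues serves infinitely often.\<close>

lemma limsup_average_residue_class:
  fixes a :: "nat \<Rightarrow> real"
  assumes "limsup (\<lambda>t. ereal (1 / real t * (\<Sum>n<t. a n))) > 0" and "R > 0"
  obtains r where "r < R"
    "limsup (\<lambda>t. ereal (1 / real t * (\<Sum>n<t. if n mod R = r then a n else 0))) > 0"
proof -
  obtain e where e: "e > 0" "\<exists>\<^sub>F t in sequentially. 1 / real t * (\<Sum>n<t. a n) > e"
    using frequently_less_if_less_limsup[OF assms(1)] .
  define b where "b r t = 1 / real t * (\<Sum>n<t. if n mod R = r then a n else 0)" for r t
  have sum_b: "1 / real t * (\<Sum>n<t. a n) = (\<Sum>r<R. b r t)" for t
  proof -
    have "(\<Sum>n<t. a n) = (\<Sum>n<t. \<Sum>r<R. if n mod R = r then a n else 0)"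
      using assms(2) by (simp add: sum.delta')
    also have "\<dots> = (\<Sum>r<R. \<Sum>n<t. if n mod R = r then a n else 0)"
      by (rule sum.swap)
    finally show ?thesis
      unfolding b_def by (simp add: sum_distrib_left)
  qed
  have "\<exists>\<^sub>F t in sequentially. \<exists>r\<in>{..<R}. b r t > e / real R"
  proof (rule frequently_mono[rule_format, OF _ e(2)], rule ccontr)
    fix t
    assume *: "e < 1 / real t * (\<Sum>n<t. a n)" and "\<not> (\<exists>r\<in>{..<R}. e / real R < b r t)"
    then have "(\<Sum>r<R. b r t) \<le> (\<Sum>r<R. e / real R)"
      by (intro sum_mono) (auto simp: not_less)
    with * assms(2) show False unfolding sum_b by simp
  qed
  from frequently_bex_finite[OF finite_lessThan this]
  obtain r where "r < R" "\<exists>\<^sub>F t in sequentially. b r t > e / real R"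
    by auto
  then show thesis
    using less_limsup_if_frequently_less[of "e / real R" "b r"] e(1) assms(2)
    by (intro that[of r]) (auto simp: b_def)
qed

subsection \<open>Block codes with a synchronising marker\<close>

text \<open>This counts \<open>l + 1\<close> zeros, a one, the \<open>l\<close> symbols of a word,
  another one and a single free symbol.\<close>

definition block_length :: "nat \<Rightarrow> nat" where
  "block_length l = 2 * l + 4"

text \<open>
  The concatenation of the blocks \<open>0\<^sup>l\<^sup>+\<^sup>1 1 w 1 c\<^sub>k\<close>, where \<open>w\<close> stands for its first \<open>l\<close> symbols. The
  prefix \<open>0\<^sup>l\<^sup>+\<^sup>1 1\<close> is too long to occur anywhere else than at the beginning of a block.
\<close>

definition block_code :: "(nat \<Rightarrow> bool) \<Rightarrow> nat \<Rightarrow> (nat \<Rightarrow> bool) \<Rightarrow> nat \<Rightarrow> bool" where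
  "block_code w l c i =
     (let r = i mod block_length l in
      if r \<le> l then False
      else if r = l + 1 then True
      else if r < 2 * l + 2 then w (r - (l + 2))
      else if r = 2 * l + 2 then True
      else c (i div block_length l))"

definition marker_at :: "nat \<Rightarrow> nat \<Rightarrow> (nat \<Rightarrow> bool) \<Rightarrow> bool" where
  "marker_at l i x \<longleftrightarrow> (\<forall>j\<le>l. \<not> x (i + j)) \<and> x (i + (l + 1))"

lemma block_length_pos: "0 < block_length l"
  by (simp add: block_length_def)

lemma block_code_eq:
  assumes "r < block_length l"
  shows "block_code w l c (k * block_length l + r) =
      (if r \<le> l then False
      else if r = l + 1 then True
      else if r < 2 * l + 2 then w (r - (l + 2))
      else if r = 2 * l + 2 then True
      else c k)"
  using assms by (simp add: block_code_def Let_def)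

text \<open>A run of \<open>l + 1\<close> zeros avoids the ones at positions \<open>l + 1\<close>
  and \<open>2 * l + 2\<close> of a block only if it starts at position \<open>0\<close> or at the
  free symbol in position \<open>2 * l + 3\<close>. In the latter case the zeros of the next block
  prolong the run, so the final one of the marker is missing.\<close>

lemma marker_at_block_code:
  "marker_at l i (block_code w l c) \<longleftrightarrow> block_length l dvd i"
proof
  assume "block_length l dvd i"
  then obtain k where i: "i = k * block_length l"
    by (metis dvdE mult.commute)
  show "marker_at l i (block_code w l c)"
    using block_code_eq[of "l + 1" l w c k] block_code_eq[of _ l w c k]
    by (auto simp: marker_at_def i block_length_def)
next
  assume *: "marker_at l i (block_code w l c)"
  define r where "r = i mod block_length l"
  define k where "k = i div block_length l"
  have i: "i = k * block_length l + r" and r: "r < block_length l"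
    by (simp_all add: r_def k_def block_length_pos)
  have zero: "\<not> block_code w l c (k * block_length l + (r + j))" if "j \<le> l" for j
    using * that by (auto simp: marker_at_def i add.assoc)
  have one: "block_code w l c (k * block_length l + (r + (l + 1)))"
    using * by (simp add: marker_at_def i add.assoc)
  have "r = 0"
  proof (rule ccontr)
    assume "r \<noteq> 0"
    consider "r \<le> l + 1" | "l + 2 \<le> r" "r \<le> 2 * l + 2" | "r = 2 * l + 3"
      using r by (force simp: block_length_def)
    then show False
    proof cases
      case 1
      with \<open>r \<noteq> 0\<close> zero[of "l + 1 - r"] show ?thesis
        using block_code_eq[of "l + 1" l w c k] by (simp add: block_length_def)
    next
      case 2
      with zero[of "2 * l + 2 - r"] show ?thesis
        using block_code_eq[of "2 * l + 2" l w c k] by (simp add: block_length_def)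
    next
      case 3
      then have "k * block_length l + (r + (l + 1)) = (k + 1) * block_length l + l"
        by (simp add: block_length_def)
      then show ?thesis
        using one block_code_eq[of l l w c "k + 1"] by (simp only:) (simp add: block_length_def)
    qed
  qed
  then show "block_length l dvd i"
    by (simp add: r_def dvd_eq_mod_eq_0)
qed

subsection \<open>Extensions of the one-sided full shift\<close>

text \<open>Continuity into the product space is stated coordinatewise, the form that makes
  cylinders closed. The map \<open>g\<close> stands for various iterates of
  \<open>f\<close>.\<close>

definition shift_extension ::
    "'a::metric_space set \<Rightarrow> ('a \<Rightarrow> 'a) \<Rightarrow> ('a \<Rightarrow> nat \<Rightarrow> bool) \<Rightarrow> bool" where
  "shift_extension K g \<pi> \<longleftrightarrow>
     compact K \<and> g ` K \<subseteq> K \<and> (\<forall>i. continuous_on K (\<lambda>x. \<pi> x i)) \<and>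
     (\<forall>x\<in>K. \<forall>i. \<pi> (g x) i = \<pi> x (Suc i)) \<and> (\<forall>c. \<exists>x\<in>K. \<pi> x = c)"

lemma funpow_into:
  assumes "f ` X \<subseteq> X" "x \<in> X"
  shows "(f ^^ n) x \<in> X"
  using assms by (induction n) auto

lemma continuous_on_funpow:
  fixes f :: "'a::topological_space \<Rightarrow> 'a"
  assumes "continuous_on X f" "f ` X \<subseteq> X"
  shows "continuous_on X (f ^^ n)"
proof (induction n)
  case (Suc n)
  have "(f ^^ n) ` X \<subseteq> X"
    using funpow_into[OF assms(2)] by blast
  with Suc show ?case
    using assms(1) by (auto intro: continuous_on_compose2)
qed simp

lemma shift_extension_funpow:
  assumes "shift_extension K g \<pi>" "x \<in> K"
  shows "(g ^^ n) x \<in> K" "\<pi> ((g ^^ n) x) i = \<pi> x (i + n)"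
proof -
  have into: "(g ^^ n) x \<in> K" for n
    using assms by (intro funpow_into) (auto simp: shift_extension_def)
  then show "(g ^^ n) x \<in> K" .
  show "\<pi> ((g ^^ n) x) i = \<pi> x (i + n)"
    using assms(1) into by (induction n arbitrary: i) (auto simp: shift_extension_def)
qed

lemma shift_extension_point_with_code:
  assumes "shift_extension K g \<pi>"
  obtains x where "x \<in> K" "\<pi> x = c"
proof -
  have "\<forall>c. \<exists>x\<in>K. \<pi> x = c"
    using assms unfolding shift_extension_def by (elim conjE)
  with that show thesis by metis
qed

lemma closed_cylinder:
  assumes "shift_extension K g \<pi>"
  shows "closed {x \<in> K. \<pi> x i = b}"
proof -
  have "closed (K \<inter> (\<lambda>x. \<pi> x i) -` {b})"
    using assms
    by (intro continuous_closed_preimage) (auto simp: shift_extension_def compact_imp_closed)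
  then show ?thesis
    by (simp add: Int_def vimage_def)
qed

text \<open>Prescribing the markers and \<open>w\<close> leaves one free symbol per block. These
  symbols still range over all sequences, and \<open>g ^^ block_length l\<close> moves the code by
  exactly one block.\<close>

lemma shift_extension_block_code:
  fixes w :: "nat \<Rightarrow> bool" and l :: nat and K :: "'a::metric_space set"
  assumes ext: "shift_extension K g \<pi>"
  defines "L \<equiv> {x \<in> K. \<exists>c. \<pi> x = block_code w l c}"
  shows "shift_extension L (g ^^ block_length l)
           (\<lambda>x k. \<pi> x (k * block_length l + (2 * l + 3)))"
proof -
  define B where "B = block_length l"
  have B: "0 < B" "2 * l + 3 < B"
    by (simp_all add: B_def block_length_def)
  have free: "block_code w l c (k * B + (2 * l + 3)) = c k" for c k
    using block_code_eq[of "2 * l + 3" l w c k] B by (simp add: B_def)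
  have fixed: "block_code w l c i = block_code w l c' i" if "i mod B \<noteq> 2 * l + 3" for c c' i
  proof -
    have "i mod B < 2 * l + 4"
      using mod_less_divisor[OF B(1), of i] by (simp add: B_def block_length_def)
    with that show ?thesis
      by (simp add: block_code_def Let_def flip: B_def)
  qed
  define z where "z = block_code w l (\<lambda>_. False)"
  \<comment> \<open>Written as an intersection of cylinders that prescribe every symbol except the
    free ones, \<open>L\<close> is seen to be closed.\<close>
  have L_eq: "L = K \<inter> (\<Inter>i\<in>{i. i mod B \<noteq> 2 * l + 3}. {x \<in> K. \<pi> x i = z i})" (is "_ = ?R")
  proof (intro equalityI subsetI)
    fix x assume "x \<in> L"
    then obtain c where c: "x \<in> K" "\<pi> x = block_code w l c"
      by (auto simp: L_def)
    have "block_code w l c i = z i" if "i mod B \<noteq> 2 * l + 3" for i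
      unfolding z_def using that by (rule fixed)
    with c show "x \<in> ?R"
      by simp
  next
    fix x assume x: "x \<in> ?R"
    have "\<pi> x = block_code w l (\<lambda>k. \<pi> x (k * B + (2 * l + 3)))"
    proof
      fix i
      show "\<pi> x i = block_code w l (\<lambda>k. \<pi> x (k * B + (2 * l + 3))) i"
      proof (cases "i mod B = 2 * l + 3")
        case True
        then have "i = i div B * B + (2 * l + 3)"
          by (metis div_mult_mod_eq)
        then show ?thesis
          using free by metis
      next
        case False
        with x have "\<pi> x i = z i" by simp
        also have "\<dots> = block_code w l (\<lambda>k. \<pi> x (k * B + (2 * l + 3))) i"
          unfolding z_def using False by (rule fixed)
        finally show ?thesis .
      qed
    qed
    with x show "x \<in> L" by (auto simp: L_def)
  qed
  have "compact L"
    unfolding L_eq using ext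
    by (intro compact_Int_closed closed_INT ballI closed_cylinder[OF ext]) (auto simp: shift_extension_def)
  moreover have "(g ^^ B) ` L \<subseteq> L"
  proof clarify
    fix x assume "x \<in> L"
    then obtain c where x: "x \<in> K" "\<pi> x = block_code w l c" by (auto simp: L_def)
    have "\<pi> ((g ^^ B) x) = block_code w l (\<lambda>k. c (Suc k))"
    proof
      fix i
      have "(i + B) mod B = i mod B" "(i + B) div B = Suc (i div B)"
        using B by simp_all
      then show "\<pi> ((g ^^ B) x) i = block_code w l (\<lambda>k. c (Suc k)) i"
        by (simp add: shift_extension_funpow(2)[OF ext x(1)] x(2) block_code_def Let_def flip: B_def)
    qed
    then show "(g ^^ B) x \<in> L"
      using shift_extension_funpow(1)[OF ext x(1)] by (auto simp: L_def)
  qed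
  moreover have "continuous_on L (\<lambda>x. \<pi> x (k * B + (2 * l + 3)))" for k
    by (rule continuous_on_subset[of K]) (use ext in \<open>simp_all add: shift_extension_def L_def\<close>)
  moreover have "\<pi> ((g ^^ B) x) (k * B + (2 * l + 3)) = \<pi> x (Suc k * B + (2 * l + 3))"
    if "x \<in> L" for x k
  proof -
    have "x \<in> K" using that by (simp add: L_def)
    then show ?thesis
      by (simp add: shift_extension_funpow(2)[OF ext] add_ac)
  qed
  moreover have "\<exists>x\<in>L. (\<lambda>k. \<pi> x (k * B + (2 * l + 3))) = c" for c
  proof -
    obtain x where "x \<in> K" "\<pi> x = block_code w l c"
      using shift_extension_point_with_code[OF ext] .
    then show ?thesis
      using free by (intro bexI[of _ x]) (auto simp: L_def)
  qed
  ultimately show "shift_extension L (g ^^ block_length l)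
           (\<lambda>x k. \<pi> x (k * block_length l + (2 * l + 3)))"
    by (simp add: shift_extension_def flip: B_def)
qed

text \<open>
  A word missing from both of two subextensions is the concatenation of a word missing from the
  first and a word missing from the second.
\<close>

lemma missing_word:
  assumes ext: "shift_extension K g \<pi>" and "finite J"
    and "\<And>j. j \<in> J \<Longrightarrow> compact (S j) \<and> S j \<subseteq> K \<and> g ` S j \<subseteq> S j \<and> (\<exists>c. \<forall>x\<in>S j. \<pi> x \<noteq> c)"
  obtains w l where "\<And>j x. j \<in> J \<Longrightarrow> x \<in> S j \<Longrightarrow> \<exists>i<l. \<pi> x i \<noteq> w i"
proof -
  have "\<exists>w l. \<forall>j\<in>J. \<forall>x\<in>S j. \<exists>i<l. \<pi> x i \<noteq> w i"
    using assms(2,3)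
  proof (induction J rule: finite_induct)
    case (insert k J)
    then obtain w l where w: "\<forall>j\<in>J. \<forall>x\<in>S j. \<exists>i<l. \<pi> x i \<noteq> w i"
      by auto
    from insert.prems[of k] obtain v where
      k: "compact (S k)" "S k \<subseteq> K" "g ` S k \<subseteq> S k" and v: "\<forall>x\<in>S k. \<pi> x \<noteq> v"
      by auto
    \<comment> \<open>If every prefix of \<open>v\<close> occurred in \<open>S k\<close>, the finite
      intersection property would yield a point of \<open>S k\<close> with code
      \<open>v\<close>.\<close>
    have "\<exists>m. \<forall>x\<in>S k. \<exists>i<m. \<pi> x i \<noteq> v i"
    proof (rule ccontr)
      assume no: "\<not> ?thesis"
      have "S k \<inter> (\<Inter>i\<in>UNIV. {x \<in> K. \<pi> x i = v i}) \<noteq> {}"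
      proof (rule compact_imp_fip_image[OF k(1) closed_cylinder[OF ext]])
        fix I :: "nat set" assume "finite I"
        then obtain m where m: "\<forall>i\<in>I. i < m"
          using finite_nat_set_iff_bounded by blast
        obtain x where "x \<in> S k" "\<forall>i<m. \<pi> x i = v i"
          using no by blast
        with m k(2) show "S k \<inter> (\<Inter>i\<in>I. {x \<in> K. \<pi> x i = v i}) \<noteq> {}"
          by blast
      qed
      then obtain x where "x \<in> S k" "\<pi> x = v"
        by auto
      with v show False by blast
    qed
    then obtain m where m: "\<forall>x\<in>S k. \<exists>i<m. \<pi> x i \<noteq> v i" ..
    \<comment> \<open>Points of the earlier sets already differ from \<open>w\<close>. For
      \<open>x\<close> in \<open>S k\<close>, invariance keeps \<open>(g ^^ l) x\<close> in
      \<open>S k\<close>, so the code of \<open>x\<close> differs from \<open>v\<close> placed after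
      \<open>l\<close> symbols.\<close>
    define u where "u i = (if i < l then w i else v (i - l))" for i
    have "\<exists>i<l + m. \<pi> x i \<noteq> u i" if x: "j \<in> insert k J" "x \<in> S j" for j x
    proof (cases "j = k")
      case True
      then have "(g ^^ l) x \<in> S k"
        using x k(3) funpow_into by auto
      then obtain i where "i < m" "\<pi> ((g ^^ l) x) i \<noteq> v i"
        using m by blast
      moreover have "x \<in> K"
        using x True k(2) by auto
      ultimately show ?thesis
        using shift_extension_funpow(2)[OF ext] by (intro exI[of _ "i + l"]) (auto simp: u_def)
    next
      case False
      then obtain i where "i < l" "\<pi> x i \<noteq> w i"
        using w x by auto
      then show ?thesis
        by (intro exI[of _ i]) (auto simp: u_def)
    qed
    then show ?case by blast
  qed auto
  with that show thesis by blast
qed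

subsection \<open>Separating a subextension from its images\<close>

text \<open>Cancel \<open>gcd t T\<close> to get coprime \<open>t'\<close> and \<open>T'\<close>,
  and let \<open>q\<close> be a prime factor of \<open>T'\<close>. With \<open>m = T' / q\<close>,
  the product \<open>m * t\<close> is \<open>t'\<close> times \<open>T / q\<close>. It is divisible
  by \<open>N\<close> because \<open>N * q\<close> divides \<open>T\<close>, and not by
  \<open>T\<close> because \<open>q\<close> does not divide \<open>t'\<close>.\<close>

lemma exists_multiple_dvd_not_dvd:
  fixes N T t :: nat
  assumes "T > 0" and primes: "\<And>q. prime q \<Longrightarrow> q dvd T \<Longrightarrow> N * q dvd T" and "\<not> T dvd t"
  obtains m where "N dvd m * t" "\<not> T dvd m * t"
proof -
  define e where "e = gcd t T"
  have "gcd t T \<noteq> 0"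
    using assms(1) by simp
  from gcd_coprime_exists[OF this]
  obtain t' T' where e: "t = e * t'" "T = e * T'" and co: "coprime t' T'"
    unfolding e_def by (metis mult.commute)
  have "T' \<noteq> 1"
    using assms(3) e by auto
  then obtain q where q: "prime q" "q dvd T'"
    using prime_factor_nat by blast
  then obtain m where m: "T' = q * m" by blast
  have pos: "e > 0" "m > 0" "q > 0"
    using assms(1) e m by auto
  have "N * q dvd (e * m) * q"
    using primes[OF q(1)] e m by (simp add: mult_ac)
  then have "N dvd e * m"
    using pos by simp
  then have "N dvd m * t"
    using e by (metis dvd_mult2 mult.assoc mult.commute)
  moreover have "\<not> T dvd m * t"
  proof
    assume "T dvd m * t"
    then have "(e * m) * q dvd (e * m) * t'"
      using e m by (simp add: mult_ac)
    then have "q dvd t'"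
      using pos by simp
    then show False
      using co q by (meson coprime_common_divisor not_prime_unit)
  qed
  ultimately show thesis by (rule that)
qed

text \<open>
  Call \<open>j mod T\<close> a phase of \<open>x\<close> if \<open>x \<in> f\<^sup>j(K)\<close>. Take a maximal set \<open>A\<close> of phases that is common
  to the points of a subextension \<open>M\<close>. Outside of a proper closed set of codes, the phases
  of \<open>x \<in> M\<close> are then exactly those in \<open>A\<close>, and \<open>x \<in> f\<^sup>t(M)\<close> makes \<open>A\<close> invariant under
  translation by \<open>t\<close>. Since every prime factor of \<open>T\<close> divides \<open>T / N\<close>, each nontrivial subgroup
  of \<open>\<int> / T\<int>\<close> contains a nonzero multiple of \<open>N\<close>, which the last assumption excludes from \<open>A\<close>.
\<close>

lemma shift_extension_separated_images:
  fixes X :: "'a::metric_space set"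
  assumes f: "continuous_on X f" "f ` X \<subseteq> X" and "K \<subseteq> X"
    and ext: "shift_extension K (f ^^ T) \<rho>" and "T > 0" and "N dvd T"
    and primes: "\<And>q. prime q \<Longrightarrow> q dvd T \<Longrightarrow> N * q dvd T"
    and disj: "\<And>r. 0 < r \<Longrightarrow> r < T \<Longrightarrow> N dvd r \<Longrightarrow> K \<inter> (f ^^ r) ` K = {}"
  obtains M l w where "M \<subseteq> K" "shift_extension M (f ^^ T) \<rho>"
    "\<forall>x\<in>M. (\<forall>i<l. \<rho> x i = w i) \<longrightarrow> (\<forall>t\<in>{0<..<T}. x \<notin> (f ^^ t) ` M)"
proof -
  define S where "S A = {x \<in> K. \<forall>j\<in>A. x \<in> (f ^^ j) ` K}" for A
  have compact_K: "compact K"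
    using ext by (simp add: shift_extension_def)
  have S_sub: "S A \<subseteq> K" for A
    by (auto simp: S_def)
  have compact_S: "compact (S A)" for A
  proof -
    have "closed ((f ^^ j) ` K)" for j
      using compact_K assms(3) continuous_on_funpow[OF f]
      by (intro compact_imp_closed compact_continuous_image) (auto intro: continuous_on_subset)
    then have "compact (K \<inter> (\<Inter>j\<in>A. (f ^^ j) ` K))"
      using compact_K by (intro compact_Int_closed closed_INT) auto
    also have "K \<inter> (\<Inter>j\<in>A. (f ^^ j) ` K) = S A"
      by (auto simp: S_def)
    finally show ?thesis .
  qed
  have into_K: "(f ^^ T) x \<in> K" if "x \<in> K" for x
    using ext that by (auto simp: shift_extension_def)
  have S_inv: "(f ^^ T) ` S A \<subseteq> S A" for A
  proof clarify
    fix x assume x: "x \<in> S A"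
    have "(f ^^ T) x \<in> (f ^^ j) ` K" if "j \<in> A" for j
    proof -
      from x that obtain y where "y \<in> K" "x = (f ^^ j) y" by (auto simp: S_def)
      then show ?thesis
        using into_K by (intro image_eqI[of _ _ "(f ^^ T) y"])
          (auto simp: add.commute simp flip: funpow_add[unfolded o_def, THEN fun_cong])
    qed
    with x into_K show "(f ^^ T) x \<in> S A" by (auto simp: S_def)
  qed
  define \<A> where "\<A> = {A. A \<subseteq> {..<T} \<and> (\<forall>c. \<exists>x\<in>S A. \<rho> x = c)}"
  have "finite \<A>"
    by (rule finite_subset[of _ "Pow {..<T}"]) (auto simp: \<A>_def)
  moreover have "{} \<in> \<A>"
    using ext by (auto simp: \<A>_def S_def shift_extension_def)
  ultimately obtain A where A: "A \<in> \<A>" and maximal: "\<forall>A'\<in>\<A>. A \<subseteq> A' \<longrightarrow> A = A'"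
    using finite_has_maximal[of \<A>] by blast
  have "\<exists>c. \<forall>x\<in>S (insert j A). \<rho> x \<noteq> c" if "j \<in> {..<T} - A" for j
  proof -
    have "insert j A \<notin> \<A>"
      using maximal that by blast
    then show ?thesis
      using that A by (auto simp: \<A>_def)
  qed
  \<comment> \<open>By maximality of \<open>A\<close>, each further phase costs some code. One word
    \<open>w\<close> handles all of them: a point of \<open>S A\<close> whose code begins with
    \<open>w\<close> has no phase outside \<open>A\<close>.\<close>
  then obtain w l where w: "\<And>j x. j \<in> {..<T} - A \<Longrightarrow> x \<in> S (insert j A) \<Longrightarrow> \<exists>i<l. \<rho> x i \<noteq> w i"
    using missing_word[OF ext, of "{..<T} - A" "\<lambda>j. S (insert j A)"] compact_S S_sub S_inv
    by (metis finite_Diff finite_lessThan)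
  show thesis
  proof (rule that[of "S A"])
    show "S A \<subseteq> K" by (rule S_sub)
    then show "shift_extension (S A) (f ^^ T) \<rho>"
      using ext compact_S S_inv A
      by (auto simp: shift_extension_def \<A>_def intro: continuous_on_subset)
    have False
      if x: "x \<in> S A" "\<forall>i<l. \<rho> x i = w i" and t: "0 < t" "t < T"
        and "x \<in> (f ^^ t) ` S A" for x t
    proof -
      from that(5) obtain y where y: "y \<in> S A" "x = (f ^^ t) y" by blast
      \<comment> \<open>If \<open>y\<close> has phase \<open>j\<close>, then \<open>x\<close> has
        phase \<open>t + j\<close>, which may be reduced modulo \<open>T\<close> because
        \<open>f ^^ T\<close> maps \<open>K\<close> into itself. The phase \<open>0\<close> of
        \<open>y\<close> comes from \<open>y\<close> lying in \<open>K\<close>, and it starts the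
        induction on multiples of \<open>t\<close>.\<close>
      have step: "(t + j) mod T \<in> A" if "j \<in> insert 0 A" for j
      proof (rule ccontr)
        assume notin: "(t + j) mod T \<notin> A"
        have "y \<in> (f ^^ j) ` K"
          using y(1) that by (auto simp: S_def)
        then obtain z where z: "z \<in> K" "y = (f ^^ j) z" by blast
        define s where "s = t + j"
        have "x = (f ^^ s) z"
          by (simp add: s_def y(2) z(2) funpow_add)
        also have "\<dots> = (f ^^ (s mod T + T * (s div T))) z"
          by simp
        also have "\<dots> = (f ^^ (s mod T)) (((f ^^ T) ^^ (s div T)) z)"
          unfolding funpow_add funpow_mult by simp
        finally have "x \<in> (f ^^ (s mod T)) ` K"
          using shift_extension_funpow(1)[OF ext z(1)] by blast
        then have "x \<in> S (insert ((t + j) mod T) A)"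
          using x(1) by (auto simp: S_def s_def)
        then show False
          using w[of "(t + j) mod T" x] notin x(2) \<open>T > 0\<close> by auto
      qed
      have multiples: "(m * t) mod T \<in> insert 0 A" for m
      proof (induction m)
        case (Suc m)
        then have "(t + (m * t) mod T) mod T \<in> A" by (rule step)
        then show ?case by (simp add: mod_simps)
      qed simp
      have "\<not> T dvd t"
        using t by (auto dest: dvd_imp_le)
      then obtain m where m: "N dvd m * t" "\<not> T dvd m * t"
        using exists_multiple_dvd_not_dvd[of T N t] \<open>T > 0\<close> primes by blast
      define r where "r = (m * t) mod T"
      have r: "0 < r" "r < T" "N dvd r"
        using m \<open>T > 0\<close> \<open>N dvd T\<close> by (simp_all add: r_def dvd_mod mod_greater_zero_iff_not_dvd)
      then have "r \<in> A"
        using multiples[of m] by (simp add: r_def)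
      then have "x \<in> K \<inter> (f ^^ r) ` K"
        using x(1) by (auto simp: S_def)
      with disj r show False by blast
    qed
    then show "\<forall>x\<in>S A. (\<forall>i<l. \<rho> x i = w i) \<longrightarrow> (\<forall>t\<in>{0<..<T}. x \<notin> (f ^^ t) ` S A)"
      by (meson greaterThanLessThan_iff)
  qed
qed

text \<open>Passing to block codes produces the hypotheses of the separation lemma for
  \<open>T = N * B\<close>: the markers keep \<open>L\<close> disjoint from its images under
  \<open>f ^^ r\<close> for multiples \<open>r\<close> of \<open>N\<close> below \<open>T\<close>,
  and every prime factor of \<open>T\<close> divides \<open>T / N = B\<close>.\<close>

lemma shift_extension_iterate_obtains:
  fixes X :: "'a::metric_space set"
  assumes f: "continuous_on X f" "f ` X \<subseteq> X" and "K \<subseteq> X" and "N > 0"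
    and ext: "shift_extension K (f ^^ N) \<pi>"
  obtains T M \<rho> l w where "T > 0" "M \<subseteq> X" "shift_extension M (f ^^ T) \<rho>"
    "\<forall>x\<in>M. (\<forall>i<l. \<rho> x i = w i) \<longrightarrow> (\<forall>t\<in>{0<..<T}. x \<notin> (f ^^ t) ` M)"
proof -
  \<comment> \<open>Chosen so that the block length is \<open>4 * N\<close>, a multiple of
    \<open>N\<close>; the subtraction is exact since \<open>N > 0\<close>.\<close>
  define l where "l = 2 * N - 2"
  define B where "B = block_length l"
  have B: "B = 4 * N"
    using \<open>N > 0\<close> by (simp add: B_def l_def block_length_def)
  define L where "L = {x \<in> K. \<exists>c. \<pi> x = block_code (\<lambda>_. False) l c}"
  define \<rho> where "\<rho> = (\<lambda>x k. \<pi> x (k * B + (2 * l + 3)))"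
  define T where "T = N * B"
  have extL: "shift_extension L (f ^^ T) \<rho>"
    using shift_extension_block_code[OF ext, of "\<lambda>_. False" l]
    by (simp add: L_def \<rho>_def T_def funpow_mult flip: B_def)
  have disj: "L \<inter> (f ^^ r) ` L = {}" if r: "0 < r" "r < T" "N dvd r" for r
  proof (rule ccontr)
    assume "L \<inter> (f ^^ r) ` L \<noteq> {}"
    then obtain x y where x: "x \<in> L" "y \<in> L" "x = (f ^^ r) y" by blast
    from r obtain i where i: "r = N * i" by blast
    with r have "0 < i" "i < B"
      by (auto simp: T_def)
    have "\<pi> x j = \<pi> y (i + j)" for j
      using shift_extension_funpow(2)[OF ext, of y i j] x i
      by (simp add: L_def funpow_mult add.commute)
    \<comment> \<open>The code of \<open>x\<close> is that of \<open>y\<close> moved by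
      \<open>i\<close>, so the marker opening the former sits at \<open>i\<close> in the latter,
      strictly inside a block.\<close>
    then have "marker_at l 0 (\<pi> x) \<longleftrightarrow> marker_at l i (\<pi> y)"
      by (simp add: marker_at_def)
    then have "B dvd i"
      using x by (auto simp: L_def B_def marker_at_block_code)
    with \<open>0 < i\<close> \<open>i < B\<close> show False
      by (auto dest: dvd_imp_le)
  qed
  have primes: "N * q dvd T" if "prime q" "q dvd T" for q
  proof -
    have "q dvd N \<or> q dvd B"
      using that by (simp add: T_def prime_dvd_mult_iff)
    then have "q dvd B" by (auto simp: B)
    then show ?thesis by (simp add: T_def mult_dvd_mono)
  qed
  have "L \<subseteq> X" "T > 0" "N dvd T"
    using assms(3) \<open>N > 0\<close> by (auto simp: L_def T_def B)
  obtain M l' w where M: "M \<subseteq> L" "shift_extension M (f ^^ T) \<rho>"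
    "\<forall>x\<in>M. (\<forall>i<l'. \<rho> x i = w i) \<longrightarrow> (\<forall>t\<in>{0<..<T}. x \<notin> (f ^^ t) ` M)"
    using shift_extension_separated_images
      [OF f \<open>L \<subseteq> X\<close> extL \<open>T > 0\<close> \<open>N dvd T\<close> primes disj] .
  show thesis
    by (rule that[OF \<open>T > 0\<close> order_trans[OF M(1) \<open>L \<subseteq> X\<close>] M(2,3)])
qed

subsection \<open>Bohr chaoticity\<close>

lemma Urysohn_closed_metric:
  fixes S D :: "'a::metric_space set"
  assumes "closed S" "closed D" "S \<inter> D = {}"
  obtains u :: "'a \<Rightarrow> real" where "continuous_on UNIV u"
    "\<forall>x\<in>S. u x = 0" "\<forall>x\<in>D. u x = 1"
proof -
  have "normal_space (euclidean :: 'a topology)"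
    by (simp add: metrizable_imp_normal_space metrizable_space_euclidean)
  then obtain u where "continuous_map euclidean (top_of_set {0..1::real}) u"
    "u ` S \<subseteq> {0}" "u ` D \<subseteq> {1}"
    using Urysohn_lemma[of euclidean S D 0 1] assms by (auto simp: disjnt_def)
  with that[of u] show thesis
    by (auto simp: continuous_map_in_subtopology)
qed

lemma shift_extension_test_function:
  fixes X :: "'a::metric_space set"
  assumes f: "continuous_on X f" "f ` X \<subseteq> X" and "T > 0" and "M \<subseteq> X"
    and ext: "shift_extension M (f ^^ T) \<rho>"
    and sep: "\<forall>x\<in>M. (\<forall>i<l. \<rho> x i = w i) \<longrightarrow> (\<forall>t\<in>{0<..<T}. x \<notin> (f ^^ t) ` M)"
  defines "R \<equiv> T * block_length l"
  obtains \<phi> :: "'a \<Rightarrow> real" where "continuous_on UNIV \<phi>"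
    "\<forall>c. \<exists>y\<in>X. \<forall>n. \<phi> ((f ^^ n) y) = (if R dvd n then if c (n div R) then 1 else - 1 else 0)"
proof -
  define E where "E b x \<longleftrightarrow> (\<forall>i\<le>2 * l + 3. \<rho> x i = block_code w l (\<lambda>_. b) i)" for b x
  define S where "S b = {x \<in> M. E b x}" for b
  define D where "D b = {x \<in> M. \<not> E b x} \<union> (\<Union>t\<in>{0<..<T}. (f ^^ t) ` M)" for b
  have compact_M: "compact M"
    using ext by (simp add: shift_extension_def)
  have bc: "block_code w l c i = (if i \<le> l then False else if i = l + 1 then True
      else if i < 2 * l + 2 then w (i - (l + 2)) else if i = 2 * l + 2 then True else c 0)"
    if "i \<le> 2 * l + 3" for c i
    using block_code_eq[of i l w c 0] that by (simp add: block_length_def)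
  have avoid: "x \<notin> (f ^^ t) ` M" if x: "x \<in> S b" and t: "0 < t" "t < T" for x b t
  proof
    assume "x \<in> (f ^^ t) ` M"
    then obtain y where y: "y \<in> M" "x = (f ^^ t) y" by blast
    \<comment> \<open>The word \<open>w\<close> occupies the positions from \<open>l + 2\<close> on
      in a block, so this iterate brings it to the front, where \<open>sep\<close> applies.\<close>
    define x' y' where "x' = ((f ^^ T) ^^ (l + 2)) x" and "y' = ((f ^^ T) ^^ (l + 2)) y"
    have "x \<in> M" using x by (simp add: S_def)
    then have "x' \<in> M" "y' \<in> M"
      unfolding x'_def y'_def using shift_extension_funpow(1)[OF ext] y(1) by blast+
    moreover have "x' = (f ^^ t) y'"
      unfolding x'_def y'_def y(2) funpow_mult
      by (simp only: add.commute flip: funpow_add[unfolded o_def, THEN fun_cong])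
    moreover have "\<rho> x' i = w i" if "i < l" for i
      using that x bc[of "i + (l + 2)" "\<lambda>_. b"] shift_extension_funpow(2)[OF ext \<open>x \<in> M\<close>, of "l + 2" i]
      by (auto simp: x'_def S_def E_def)
    ultimately show False
      using sep t by (metis greaterThanLessThan_iff imageI)
  qed
  have "closed (S b)" "closed (D b)" "S b \<inter> D b = {}" for b
  proof -
    have "closed (M \<inter> (\<Inter>i\<in>{..2 * l + 3}. {x \<in> M. \<rho> x i = block_code w l (\<lambda>_. b) i}))"
      using compact_M by (intro closed_Int closed_INT ballI closed_cylinder[OF ext])
        (simp add: compact_imp_closed)
    also have "\<dots> = M \<inter> S b"
      by (auto simp: S_def E_def)
    finally show "closed (S b)"
      by (simp add: S_def Int_def)
    have "closed ((f ^^ t) ` M)" for t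
      using compact_M assms(4) continuous_on_funpow[OF f]
      by (intro compact_imp_closed compact_continuous_image) (auto intro: continuous_on_subset)
    \<comment> \<open>Symbols being Boolean, the failure of \<open>E b\<close> is a finite union of
      cylinders and hence a closed condition.\<close>
    then have "closed ((\<Union>i\<in>{..2 * l + 3}. {x \<in> M. \<rho> x i = (\<not> block_code w l (\<lambda>_. b) i)}) \<union>
        (\<Union>t\<in>{0<..<T}. (f ^^ t) ` M))"
      by (intro closed_Un closed_UN ballI closed_cylinder[OF ext]) auto
    also have "\<dots> = D b"
      by (auto simp: D_def E_def)
    finally show "closed (D b)" .
    show "S b \<inter> D b = {}"
    proof (rule ccontr)
      assume "S b \<inter> D b \<noteq> {}"
      then obtain x where "x \<in> S b" "x \<in> D b" by blast
      then obtain t where "t \<in> {0<..<T}" "x \<in> (f ^^ t) ` M"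
        by (auto simp: D_def S_def)
      with avoid[OF \<open>x \<in> S b\<close>] show False by simp
    qed
  qed
  note closed_SD = this
  have "\<exists>u::'a \<Rightarrow> real. continuous_on UNIV u \<and> (\<forall>x\<in>D b. u x = 0) \<and> (\<forall>x\<in>S b. u x = 1)" for b
  proof -
    have disjoint: "D b \<inter> S b = {}"
      using closed_SD(3)[of b] by blast
    obtain u :: "'a \<Rightarrow> real" where "continuous_on UNIV u"
      "\<forall>x\<in>D b. u x = 0" "\<forall>x\<in>S b. u x = 1"
      using Urysohn_closed_metric[OF closed_SD(2,1) disjoint] .
    then show ?thesis
      by (intro exI[of _ u]) simp
  qed
  then have "\<exists>u :: bool \<Rightarrow> 'a \<Rightarrow> real. \<forall>b. continuous_on UNIV (u b) \<and>
      (\<forall>x\<in>D b. u b x = 0) \<and> (\<forall>x\<in>S b. u b x = 1)"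
    by (intro choice allI)
  then obtain u :: "bool \<Rightarrow> 'a \<Rightarrow> real" where u: "\<And>b. continuous_on UNIV (u b)"
    "\<And>b x. x \<in> D b \<Longrightarrow> u b x = 0" "\<And>b x. x \<in> S b \<Longrightarrow> u b x = 1"
    by blast
  show thesis
  proof (rule that[of "\<lambda>x. u True x - u False x"])
    show "continuous_on UNIV (\<lambda>x. u True x - u False x)"
      by (intro continuous_intros u)
    have "\<exists>y\<in>X. \<forall>n. u True ((f ^^ n) y) - u False ((f ^^ n) y) =
        (if R dvd n then if c (n div R) then 1 else - 1 else 0)" for c
    proof -
      obtain y where y: "y \<in> M" "\<rho> y = block_code w l c"
        using shift_extension_point_with_code[OF ext] .
      have "u True ((f ^^ n) y) - u False ((f ^^ n) y) =
          (if R dvd n then if c (n div R) then 1 else - 1 else 0)" for n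
      proof (cases "T dvd n")
        case False
        define m where "m = n div T"
        have "(f ^^ n) y = (f ^^ (n mod T + T * (n div T))) y"
          by simp
        also have "\<dots> = (f ^^ (n mod T)) (((f ^^ T) ^^ m) y)"
          unfolding funpow_add funpow_mult m_def by simp
        finally have "(f ^^ n) y \<in> (f ^^ (n mod T)) ` M"
          using shift_extension_funpow(1)[OF ext y(1)] by blast
        moreover have "n mod T \<in> {0<..<T}"
          using False \<open>T > 0\<close> by (auto simp: dvd_eq_mod_eq_0)
        ultimately have "(f ^^ n) y \<in> D b" for b
          by (auto simp: D_def)
        moreover have "\<not> R dvd n"
          using False by (auto simp: R_def dest: dvd_mult_left)
        ultimately show ?thesis
          by (simp add: u(2))
      next
        case True
        then obtain m where n: "n = T * m" by blast
        define z where "z = (f ^^ n) y"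
        have z: "z = ((f ^^ T) ^^ m) y"
          by (simp add: z_def n funpow_mult)
        have zM: "z \<in> M" and \<rho>z: "\<rho> z i = block_code w l c (i + m)" for i
          using shift_extension_funpow[OF ext y(1)] by (simp_all add: z y(2))
        show ?thesis
        proof (cases "block_length l dvd m")
          case False
          have "\<not> E b z" for b
          proof
            assume "E b z"
            then have "marker_at l 0 (\<rho> z)"
              using marker_at_block_code[of l 0 w "\<lambda>_. b"] by (auto simp: marker_at_def E_def)
            then have "marker_at l m (block_code w l c)"
              by (simp add: marker_at_def \<rho>z add_ac)
            with False show False
              by (simp add: marker_at_block_code)
          qed
          then have "z \<in> D b" for b
            using zM by (auto simp: D_def)
          moreover have "\<not> R dvd n"
            using False \<open>T > 0\<close> by (simp add: R_def n)
          ultimately show ?thesis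
            by (simp add: u(2) flip: z_def)
        next
          case True
          then obtain k where m: "m = k * block_length l"
            by (metis dvdE mult.commute)
          have nR: "n = R * k"
            by (simp add: n m R_def mult_ac)
          have "R > 0"
            using \<open>T > 0\<close> by (simp add: R_def block_length_pos)
          \<comment> \<open>At the start of block \<open>k\<close>, the code agrees with the test
            block except possibly in the free symbol \<open>c k\<close>.\<close>
          have "E b z \<longleftrightarrow> b = c k" for b
          proof -
            have "\<rho> z i = block_code w l (\<lambda>_. c k) i" if "i \<le> 2 * l + 3" for i
              using block_code_eq[of i l w c k] bc[OF that, of "\<lambda>_. c k"] that
              by (simp add: \<rho>z m add.commute block_length_def)
            then show ?thesis
              using bc[of "2 * l + 3"] by (auto simp: E_def)
          qed
          then have "z \<in> S (c k)" "z \<in> D (\<not> c k)"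
            using zM by (auto simp: S_def D_def)
          then have "u (c k) z = 1" "u (\<not> c k) z = 0"
            by (auto simp: u)
          moreover have "R dvd n" "n div R = k"
            using nR \<open>R > 0\<close> by simp_all
          ultimately show ?thesis
            by (cases "c k") (simp_all flip: z_def)
        qed
      qed
      with y(1) assms(4) show ?thesis by blast
    qed
    then show "\<forall>c. \<exists>y\<in>X. \<forall>n. u True ((f ^^ n) y) - u False ((f ^^ n) y) =
        (if R dvd n then if c (n div R) then 1 else - 1 else 0)" ..
  qed
qed

text \<open>The code of \<open>y\<close> records the signs of the weight on a residue class modulo
  \<open>R\<close> that carries positive upper mean. Each product of weight and test function is
  then \<open>\<bar>\<theta> n\<bar>\<close> on this class and \<open>0\<close> off it.\<close>

lemma Bohr_chaotic_if_shift_extension: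
  fixes X :: "'a::metric_space set"
  assumes f: "continuous_on X f" "f ` X \<subseteq> X" and "K \<subseteq> X" and "N > 0"
    and ext: "shift_extension K (f ^^ N) \<pi>"
  shows "Bohr_chaotic X f"
  unfolding Bohr_chaotic_def
proof (intro allI impI)
  fix \<theta> :: "nat \<Rightarrow> real"
  assume \<theta>: "nontrivial_weight \<theta>"
  obtain T M \<rho> l w where "T > 0" and M: "M \<subseteq> X" "shift_extension M (f ^^ T) \<rho>"
    "\<forall>x\<in>M. (\<forall>i<l. \<rho> x i = w i) \<longrightarrow> (\<forall>t\<in>{0<..<T}. x \<notin> (f ^^ t) ` M)"
    using shift_extension_iterate_obtains[OF assms] .
  define R where "R = T * block_length l"
  have "R > 0"
    using \<open>T > 0\<close> by (simp add: R_def block_length_pos)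
  obtain \<phi> :: "'a \<Rightarrow> real" where \<phi>: "continuous_on UNIV \<phi>"
    "\<forall>c. \<exists>y\<in>X. \<forall>n. \<phi> ((f ^^ n) y) = (if R dvd n then if c (n div R) then 1 else - 1 else 0)"
    using shift_extension_test_function[OF f \<open>T > 0\<close> M] unfolding R_def .
  obtain r where r: "r < R"
    "limsup (\<lambda>t. ereal (1 / real t * (\<Sum>n<t. if n mod R = r then \<bar>\<theta> n\<bar> else 0))) > 0"
    using limsup_average_residue_class[of "\<lambda>n. \<bar>\<theta> n\<bar>" R] \<theta> \<open>R > 0\<close>
    by (auto simp: nontrivial_weight_def)
  obtain y where y: "y \<in> X" "\<And>n. \<phi> ((f ^^ n) y) =
      (if R dvd n then if \<theta> ((n div R) * R + r - R) \<ge> 0 then 1 else - 1 else 0)"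
    \<comment> \<open>Starting from \<open>(f ^^ (R - r)) y\<close>, time
      \<open>n = q * R + r\<close> reaches block \<open>k = q + 1\<close>, whence the index
      \<open>k * R + r - R = n\<close>. Block \<open>0\<close>, where the subtraction truncates, is
      never read.\<close>
    using \<phi>(2)[rule_format, of "\<lambda>k. \<theta> (k * R + r - R) \<ge> 0"] by blast
  define x where "x = (f ^^ (R - r)) y"
  have "\<theta> n * \<phi> ((f ^^ n) x) = (if n mod R = r then \<bar>\<theta> n\<bar> else 0)" for n
  proof -
    have x: "(f ^^ n) x = (f ^^ (n + (R - r))) y"
      by (simp add: x_def funpow_add)
    show ?thesis
    proof (cases "n mod R = r")
      case True
      then have "n = n div R * R + r"
        by (metis div_mult_mod_eq)
      then have eq: "n + (R - r) = (n div R + 1) * R"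
        using r(1) by (simp add: algebra_simps)
      then have "(n + (R - r)) div R * R + r - R = n"
        using \<open>R > 0\<close> r(1) by simp
      moreover have "R dvd n + (R - r)"
        using eq by simp
      ultimately show ?thesis
        using True unfolding x y(2) by simp
    next
      case False
      have "\<not> R dvd n + (R - r)"
      proof
        assume "R dvd n + (R - r)"
        then have "(n + (R - r) + r) mod R = r mod R"
          by (metis add.left_neutral dvd_eq_mod_eq_0 mod_add_left_eq)
        with False r(1) show False by simp
      qed
      with False show ?thesis
        unfolding x y(2) by simp
    qed
  qed
  then have "(\<Sum>n<t. \<theta> n * \<phi> ((f ^^ n) x)) = (\<Sum>n<t. if n mod R = r then \<bar>\<theta> n\<bar> else 0)" for t
    by simp
  moreover have "\<bar>\<Sum>n<t. if n mod R = r then \<bar>\<theta> n\<bar> else 0\<bar> =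
      (\<Sum>n<t. if n mod R = r then \<bar>\<theta> n\<bar> else 0)" for t
    by (intro abs_of_nonneg sum_nonneg) auto
  ultimately have
    "limsup (\<lambda>t. ereal (1 / real t * \<bar>\<Sum>n<t. \<theta> n * \<phi> ((f ^^ n) x)\<bar>)) > 0"
    using r(2) by simp
  moreover have "x \<in> X"
    using funpow_into[OF f(2) y(1)] by (simp add: x_def)
  moreover have "continuous_on X \<phi>"
    using \<phi>(1) by (rule continuous_on_subset) simp
  ultimately show "\<exists>\<phi>. \<exists>x\<in>X. continuous_on X \<phi> \<and>
      limsup (\<lambda>N. ereal (1 / real N * \<bar>\<Sum>n<N. \<theta> n * \<phi> ((f ^^ n) x)\<bar>)) > 0"
    by blast
qed

section \<open>Semi-horseshoes as extensions of the one-sided shift\<close>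

lemma shift_extension_if_one_sided:
  assumes "one_sided_semi_horseshoe X f N \<Lambda>"
  shows "\<exists>\<pi>. shift_extension \<Lambda> (f ^^ N) \<pi>"
proof -
  from assms obtain \<pi> :: "'a \<Rightarrow> nat \<Rightarrow> bool" where "compact \<Lambda>" "(f ^^ N) ` \<Lambda> \<subseteq> \<Lambda>"
    and \<pi>: "continuous_on \<Lambda> \<pi>" "\<pi> ` \<Lambda> = UNIV" "\<forall>x\<in>\<Lambda>. \<pi> ((f ^^ N) x) = left_shift (\<pi> x)"
    by (auto simp: one_sided_semi_horseshoe_def subsystem_of_iterate_def)
  moreover have "\<exists>x\<in>\<Lambda>. \<pi> x = c" for c
    using \<pi>(2) by (metis UNIV_I imageE)
  ultimately have "shift_extension \<Lambda> (f ^^ N) \<pi>"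
    by (simp add: shift_extension_def left_shift_def continuous_on_product_then_coordinatewise)
  then show ?thesis by blast
qed

text \<open>Forgetting the negative coordinates is a continuous surjection onto the one-sided shift
  that commutes with the shifts.\<close>

lemma shift_extension_if_two_sided:
  assumes "two_sided_semi_horseshoe X f N \<Lambda>"
  shows "\<exists>\<pi>. shift_extension \<Lambda> (f ^^ N) \<pi>"
proof -
  from assms obtain \<pi> :: "'a \<Rightarrow> int \<Rightarrow> bool" where "compact \<Lambda>" "(f ^^ N) ` \<Lambda> \<subseteq> \<Lambda>"
    and \<pi>: "continuous_on \<Lambda> \<pi>" "\<pi> ` \<Lambda> = UNIV" "\<forall>x\<in>\<Lambda>. \<pi> ((f ^^ N) x) = left_shift (\<pi> x)"
    by (auto simp: two_sided_semi_horseshoe_def subsystem_of_iterate_def)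
  moreover have "\<exists>x\<in>\<Lambda>. (\<lambda>i. \<pi> x (int i)) = c" for c
  proof -
    \<comment> \<open>A one-sided sequence is extended to negative indices by the constant
      \<open>c 0\<close>.\<close>
    obtain x where "x \<in> \<Lambda>" "\<pi> x = (\<lambda>i. c (nat i))"
      using \<pi>(2) by (metis UNIV_I imageE)
    then show ?thesis by (intro bexI[of _ x]) auto
  qed
  ultimately have "shift_extension \<Lambda> (f ^^ N) (\<lambda>x i. \<pi> x (int i))"
    by (simp add: shift_extension_def left_shift_def continuous_on_product_then_coordinatewise add.commute)
  then show ?thesis by blast
qed

theorem theoremA:
  fixes X :: "'a::metric_space set" and f :: "'a \<Rightarrow> 'a"
  assumes "top_dyn_system X f"
    and "has_semi_horseshoe X f"
  shows "Bohr_chaotic X f"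
proof -
  obtain N \<Lambda> where \<Lambda>: "one_sided_semi_horseshoe X f N \<Lambda> \<or> two_sided_semi_horseshoe X f N \<Lambda>"
    using assms(2) by (auto simp: has_semi_horseshoe_def)
  then obtain \<pi> where "shift_extension \<Lambda> (f ^^ N) \<pi>"
    using shift_extension_if_one_sided shift_extension_if_two_sided by blast
  moreover from \<Lambda> have "N > 0" "\<Lambda> \<subseteq> X"
    by (auto simp: one_sided_semi_horseshoe_def two_sided_semi_horseshoe_def
        subsystem_of_iterate_def)
  ultimately show ?thesis
    using assms(1) Bohr_chaotic_if_shift_extension by (auto simp: top_dyn_system_def)
qed

end
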